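(* There exists an adaptive randomized algorithm that, when the degeneracy $d$ of the hidden graph is known, solves the Graph Reconstruction problem with a CC oracle using $\mathcal{O}(d^2\log^2 n)$ CC queries, where $n$ is the number of vertices; its output is correct with high probability.
   Context: Graph Reconstruction (GR): an unknown ("hidden") simple undirected graph $G=(V,E)$ on a known vertex set $V$ with $|V|=n$ is to be determined, i.e. the algorithm must output $E$. A CC oracle, on query $S\subseteq V$, returns the partition of $S$ into the vertex sets of the connected components of the induced subgraph $G[S]$; complexity is the number of queries. An adaptive algorithm may choose queries depending on earlier answers. "Correct with high probability" means the output equals the hidden graph with probability tending to $1$ as $n\to\infty$. The degeneracy of a graph is the smallest integer $d$ such that every induced subgraph has a vertex of degree at most $d$. *)

theory Defs
  imports "HOL-Probability.Probability"
begin

definition simple_graph :: "'v set \<Rightarrow> 'v set set \<Rightarrow> bool" where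
  "simple_graph V E \<longleftrightarrow> finite V \<and> (\<forall>e\<in>E. e \<subseteq> V \<and> card e = 2)"

definition induced_edges :: "'v set set \<Rightarrow> 'v set \<Rightarrow> 'v set set" where
  "induced_edges E S = {e \<in> E. e \<subseteq> S}"

definition degree :: "'v set set \<Rightarrow> 'v \<Rightarrow> nat" where
  "degree E v = card {e \<in> E. v \<in> e}"

text \<open>Induced subgraphs are taken on nonempty vertex sets; the null graph gets degeneracy 0.\<close>
definition degeneracy :: "'v set \<Rightarrow> 'v set set \<Rightarrow> nat" where
  "degeneracy V E =
    (LEAST d. \<forall>U. U \<subseteq> V \<and> U \<noteq> {} \<longrightarrow> (\<exists>v\<in>U. degree (induced_edges E U) v \<le> d))"

definition connected_in :: "'v set set \<Rightarrow> 'v set \<Rightarrow> ('v \<times> 'v) set" where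
  "connected_in E S = {(u, v). {u, v} \<in> induced_edges E S}\<^sup>* \<inter> S \<times> S"

definition cc_oracle :: "'v set set \<Rightarrow> 'v set \<Rightarrow> 'v set set" where
  "cc_oracle E S = S // connected_in E S"

text \<open>A deterministic adaptive algorithm is a decision tree: it either outputs an edge set, or
  asks a query and continues depending on the answer. A randomized algorithm is a probability
  distribution over such trees.\<close>
datatype 'v strategy =
    Output "'v set set"
  | Query "'v set" "'v set set \<Rightarrow> 'v strategy"

primrec result :: "('v set \<Rightarrow> 'v set set) \<Rightarrow> 'v strategy \<Rightarrow> 'v set set" where
  "result orc (Output F) = F"
| "result orc (Query S k) = result orc (k (orc S))"

primrec queries :: "('v set \<Rightarrow> 'v set set) \<Rightarrow> 'v strategy \<Rightarrow> 'v set list" where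
  "queries orc (Output F) = []"
| "queries orc (Query S k) = S # queries orc (k (orc S))"

end

theory Submission
  imports Defs "HOL-Library.Log_Nat"
begin

text \<open>
  Sample a set \<open>S\<close> by keeping every vertex independently with probability \<open>1 / (8 d)\<close>. If \<open>u\<close> has
  at most \<open>4 d\<close> neighbours and \<open>v\<close> is not one of them, then with probability of order \<open>1 / d\<^sup>2\<close>
  the set \<open>S\<close> contains \<open>u\<close> and \<open>v\<close> but no neighbour of \<open>u\<close>; the answer to \<open>S\<close> then shows that
  \<open>u\<close> and \<open>v\<close> are not adjacent. Hence \<open>O(d\<^sup>2 log n)\<close> samples reveal all edges at vertices of degree
  at most \<open>4 d\<close>. A graph of degeneracy \<open>d\<close> has at most \<open>d n\<close> edges, so these are at least half of
  the vertices; they are removed, and \<open>O(log n)\<close> such rounds exhaust the graph. The same samples,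
  intersected with the remaining vertices, serve in every round: as long as no round has failed, the
  remaining vertices are determined by the graph alone and do not depend on the samples.
\<close>

section \<open>Degeneracy and the cores of a graph\<close>

lemma simple_graph_finite_edges:
  assumes "simple_graph V E"
  shows "finite E"
proof -
  have "E \<subseteq> Pow V" "finite V" using assms by (auto simp: simple_graph_def)
  thus ?thesis by (meson finite_Pow_iff finite_subset)
qed

lemma simple_graph_edgeE:
  assumes "simple_graph V E" "e \<in> E"
  obtains u v where "e = {u, v}" "u \<noteq> v" "u \<in> V" "v \<in> V"
proof -
  have "card e = 2" "e \<subseteq> V" using assms by (auto simp: simple_graph_def)
  thus thesis using that by (metis card_2_iff insert_subset)
qed

lemma finite_induced_edges: "finite E \<Longrightarrow> finite (induced_edges E U)"
  by (simp add: induced_edges_def)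

lemma degree_le_card_edges:
  assumes "finite E"
  shows "degree (induced_edges E U) v \<le> card E"
  unfolding degree_def induced_edges_def by (rule card_mono) (use assms in auto)

lemma degeneracy_witness:
  assumes "simple_graph V E" "U \<subseteq> V" "U \<noteq> {}"
  shows "\<exists>v\<in>U. degree (induced_edges E U) v \<le> degeneracy V E"
proof -
  let ?P = "\<lambda>d. \<forall>U. U \<subseteq> V \<and> U \<noteq> {} \<longrightarrow> (\<exists>v\<in>U. degree (induced_edges E U) v \<le> d)"
  \<comment> \<open>No degree exceeds \<open>card E\<close>, so some bound exists and
    \<open>LeastI\<close> applies to the \<open>LEAST\<close> in \<open>degeneracy\<close>.\<close>
  have "?P (card E)"
    using degree_le_card_edges[OF simple_graph_finite_edges[OF assms(1)]] by blast
  hence "?P (degeneracy V E)" unfolding degeneracy_def by (rule LeastI)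
  thus ?thesis using assms by blast
qed

lemma degeneracy_eq_0_iff:
  assumes "simple_graph V E"
  shows "degeneracy V E = 0 \<longleftrightarrow> E = {}"
proof
  assume d: "degeneracy V E = 0"
  show "E = {}"
  proof (rule ccontr)
    assume "E \<noteq> {}"
    then obtain e where e: "e \<in> E" by blast
    then obtain u v where uv: "e = {u, v}" "u \<in> V" "v \<in> V"
      using simple_graph_edgeE[OF assms] by metis
    \<comment> \<open>An edge taken as a vertex set: both of its endpoints have positive degree in
      the subgraph it induces.\<close>
    from degeneracy_witness[OF assms, of e] uv d
    obtain w where w: "w \<in> e" "degree (induced_edges E e) w = 0" by auto
    have "finite {f \<in> induced_edges E e. w \<in> f}"
      using finite_induced_edges[OF simple_graph_finite_edges[OF assms]] by simp
    with w have "{f \<in> induced_edges E e. w \<in> f} = {}" by (simp add: degree_def)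
    with e w show False by (auto simp: induced_edges_def)
  qed
next
  assume "E = {}"
  hence "\<forall>U. U \<subseteq> V \<and> U \<noteq> {} \<longrightarrow> (\<exists>v\<in>U. degree (induced_edges E U) v \<le> 0)"
    by (auto simp: degree_def induced_edges_def)
  thus "degeneracy V E = 0" unfolding degeneracy_def by (simp add: Least_eq_0)
qed

text \<open>Gives \<open>log 2 (card V) >= 1\<close> later, which absorbs the rounding in the number
  of rounds.\<close>

lemma card_ge_2_if_degeneracy_pos:
  assumes "simple_graph V E" "degeneracy V E > 0"
  shows "card V \<ge> 2"
proof -
  from assms(2) obtain e where "e \<in> E" using degeneracy_eq_0_iff[OF assms(1)] by auto
  then have "e \<subseteq> V" "card e = 2" "finite V" using assms by (auto simp: simple_graph_def)
  thus ?thesis by (metis card_mono)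
qed

text \<open>Deleting a vertex of degree at most the degeneracy loses at most that many edges; induct
  on the rest.\<close>

lemma card_induced_edges_le:
  assumes G: "simple_graph V E" and "U \<subseteq> V"
  shows "card (induced_edges E U) \<le> degeneracy V E * card U"
proof -
  have "finite U" using assms by (auto simp: simple_graph_def intro: finite_subset)
  thus ?thesis using \<open>U \<subseteq> V\<close>
  proof (induction U rule: finite_psubset_induct)
    case (psubset U)
    show ?case
    proof (cases "U = {}")
      case True
      have "induced_edges E {} = {}"
        using G by (auto simp: induced_edges_def simple_graph_def)
      thus ?thesis using True by simp
    next
      case False
      from degeneracy_witness[OF G psubset.prems False]
      obtain v where v: "v \<in> U" "degree (induced_edges E U) v \<le> degeneracy V E" by blast
      have "induced_edges E U = induced_edges E (U - {v}) \<union> {e \<in> induced_edges E U. v \<in> e}"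
        by (auto simp: induced_edges_def)
      hence "card (induced_edges E U) \<le> card (induced_edges E (U - {v})) + degree (induced_edges E U) v"
        unfolding degree_def by (metis card_Un_le)
      also have "card (induced_edges E (U - {v})) \<le> degeneracy V E * card (U - {v})"
        by (rule psubset.IH) (use v psubset.prems in auto)
      finally have "card (induced_edges E U) \<le> degeneracy V E * Suc (card (U - {v}))"
        using v by simp
      also have "Suc (card (U - {v})) = card U"
        using v psubset.hyps by (metis card.remove)
      finally show ?thesis .
    qed
  qed
qed

text \<open>Handshake lemma, by double counting incidences.\<close>

lemma sum_degree_induced_edges:
  assumes G: "simple_graph V E" and "U \<subseteq> V"
  shows "(\<Sum>v\<in>U. degree (induced_edges E U) v) = 2 * card (induced_edges E U)"
  unfolding degree_def
proof (rule sum_multicount)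
  show "finite U" using assms by (auto simp: simple_graph_def intro: finite_subset)
  show "finite (induced_edges E U)"
    using finite_induced_edges simple_graph_finite_edges[OF G] by blast
  show "\<forall>e\<in>induced_edges E U. card {v \<in> U. v \<in> e} = 2"
  proof
    fix e assume "e \<in> induced_edges E U"
    hence "e \<subseteq> U" "card e = 2" using G by (auto simp: induced_edges_def simple_graph_def)
    moreover from this have "{v \<in> U. v \<in> e} = e" by auto
    ultimately show "card {v \<in> U. v \<in> e} = 2" by simp
  qed
qed

section \<open>Iterated removal of low-degree vertices\<close>

text \<open>The vertex sets left by an ideal run that knows all degrees; the samples do not
  enter.\<close>

primrec core :: "'v set \<Rightarrow> 'v set set \<Rightarrow> nat \<Rightarrow> nat \<Rightarrow> 'v set" where
  "core V E t 0 = V"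
| "core V E t (Suc i) = {v \<in> core V E t i. t < degree (induced_edges E (core V E t i)) v}"

lemma core_subset: "core V E t i \<subseteq> V"
  by (induction i) auto

text \<open>Markov's inequality: the average degree inside \<open>U\<close> is at most
  \<open>2 * d\<close>, so at most half of \<open>U\<close> lies above twice that value.\<close>

lemma card_high_degree_le:
  assumes G: "simple_graph V E" and U: "U \<subseteq> V" and d: "d = degeneracy V E" "d > 0"
  shows "2 * card {v \<in> U. 4 * d < degree (induced_edges E U) v} \<le> card U"
proof -
  let ?H = "{v \<in> U. 4 * d < degree (induced_edges E U) v}"
  have fin: "finite U" using assms by (auto simp: simple_graph_def intro: finite_subset)
  have "card ?H * (4 * d) = (\<Sum>v\<in>?H. 4 * d)" by simp
  also have "\<dots> \<le> (\<Sum>v\<in>?H. degree (induced_edges E U) v)" by (rule sum_mono) auto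
  also have "\<dots> \<le> (\<Sum>v\<in>U. degree (induced_edges E U) v)"
    by (rule sum_mono2) (use fin in auto)
  also have "\<dots> \<le> 2 * (d * card U)"
    using sum_degree_induced_edges[OF G U] card_induced_edges_le[OF G U] d by simp
  finally show ?thesis using d by (simp add: algebra_simps)
qed

lemma card_core_le:
  assumes "simple_graph V E" "d = degeneracy V E" "d > 0"
  shows "2 ^ i * card (core V E (4 * d) i) \<le> card V"
proof (induction i)
  case (Suc i)
  have "2 ^ Suc i * card (core V E (4 * d) (Suc i))
      = 2 ^ i * (2 * card (core V E (4 * d) (Suc i)))" by simp
  also have "\<dots> \<le> 2 ^ i * card (core V E (4 * d) i)"
    using card_high_degree_le[OF assms(1) core_subset assms(2,3)] by (intro mult_left_mono) auto
  finally show ?case using Suc by linarith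
qed simp

lemma core_eq_empty:
  assumes "simple_graph V E" "d = degeneracy V E" "d > 0" "card V < 2 ^ i"
  shows "core V E (4 * d) i = {}"
proof -
  have "2 ^ i * card (core V E (4 * d) i) < 2 ^ i"
    using card_core_le[OF assms(1-3), of i] assms(4) by (rule le_less_trans)
  hence "card (core V E (4 * d) i) = 0" by (metis less_one mult.right_neutral mult_less_cancel1)
  moreover have "finite (core V E (4 * d) i)"
    using assms(1) core_subset unfolding simple_graph_def by (metis finite_subset)
  ultimately show ?thesis by simp
qed

section \<open>Separation by component queries\<close>

lemma equiv_connected_in: "equiv S (connected_in E S)"
proof (rule equivI)
  have "sym ({(u, v). {u, v} \<in> induced_edges E S}\<^sup>*)"
    by (intro sym_rtrancl symI) (auto simp: insert_commute)
  thus "sym (connected_in E S)"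
    by (auto simp: connected_in_def sym_def)
  show "refl_on S (connected_in E S)" by (auto simp: connected_in_def refl_on_def)
  show "trans (connected_in E S)"
    by (auto simp: connected_in_def intro!: transI intro: rtrancl_trans)
qed (auto simp: connected_in_def)

text \<open>Phrased through the answers alone, so that the algorithm can evaluate it without knowing
  \<open>E\<close>.\<close>

definition separated :: "'v set set list \<Rightarrow> 'v \<Rightarrow> 'v \<Rightarrow> bool" where
  "separated as u v \<longleftrightarrow> (\<exists>P\<in>set as. \<exists>A\<in>P. \<exists>B\<in>P. u \<in> A \<and> v \<in> B \<and> A \<noteq> B)"

text \<open>The error is one-sided: adjacent vertices in a common query share a component, so no
  true edge is ever ruled out.\<close>

lemma edge_not_separated:
  assumes "{u, v} \<in> E"
  shows "\<not> separated (map (cc_oracle E) Ss) u v"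
proof
  assume "separated (map (cc_oracle E) Ss) u v"
  then obtain S A B where *: "A \<in> S // connected_in E S" "B \<in> S // connected_in E S"
    "u \<in> A" "v \<in> B" "A \<noteq> B"
    by (auto simp: separated_def cc_oracle_def)
  have "u \<in> S" "v \<in> S" using * in_quotient_imp_subset[OF equiv_connected_in] by blast+
  hence "(u, v) \<in> connected_in E S"
    using assms by (auto simp: connected_in_def induced_edges_def)
  with * show False using quotient_eq_iff[OF equiv_connected_in] by metis
qed

lemma separated_commute: "separated as u v \<longleftrightarrow> separated as v u"
  unfolding separated_def by blast

text \<open>Only neighbours inside \<open>W\<close> count, because the query made from the sample
  \<open>S\<close> is \<open>S \<inter> W\<close>.\<close>

definition isolates :: "'v set set \<Rightarrow> 'v set \<Rightarrow> 'v \<Rightarrow> 'v \<Rightarrow> 'v set \<Rightarrow> bool" where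
  "isolates E W u v S \<longleftrightarrow> u \<in> S \<and> v \<in> S \<and> (\<forall>w\<in>W. {u, w} \<in> E \<longrightarrow> w \<notin> S)"

text \<open>No neighbour of \<open>u\<close> survives in \<open>S \<inter> W\<close>, so
  \<open>u\<close> forms a component of its own.\<close>

lemma isolates_imp_separated:
  assumes "S \<in> set Ss" "isolates E W u v S" "u \<in> W" "v \<in> W" "u \<noteq> v"
  shows "separated (map (cc_oracle E) (map (\<lambda>S. S \<inter> W) Ss)) u v"
proof -
  let ?S = "S \<inter> W"
  let ?R = "connected_in E ?S"
  have mem: "u \<in> ?S" "v \<in> ?S" using assms by (auto simp: isolates_def)
  have "(u, v) \<notin> ?R"
  proof
    assume "(u, v) \<in> ?R"
    hence "(u, v) \<in> {(u, v). {u, v} \<in> induced_edges E ?S}\<^sup>*" by (simp add: connected_in_def)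
    \<comment> \<open>A path from \<open>u\<close> to another vertex has a first edge, and it is
      incident to \<open>u\<close>.\<close>
    then obtain w where "{u, w} \<in> induced_edges E ?S"
      using \<open>u \<noteq> v\<close> by (auto elim: converse_rtranclE)
    thus False using assms(2) by (auto simp: induced_edges_def isolates_def)
  qed
  hence "?R `` {u} \<noteq> ?R `` {v}"
    using eq_equiv_class_iff[OF equiv_connected_in mem] by simp
  moreover have "u \<in> ?R `` {u}" "v \<in> ?R `` {v}"
    using mem equiv_class_self[OF equiv_connected_in] by metis+
  moreover have "?R `` {u} \<in> cc_oracle E ?S" "?R `` {v} \<in> cc_oracle E ?S"
    using mem by (auto simp: cc_oracle_def intro: quotientI)
  moreover have "cc_oracle E ?S \<in> set (map (cc_oracle E) (map (\<lambda>S. S \<inter> W) Ss))"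
    using assms(1) by auto
  ultimately show ?thesis unfolding separated_def by metis
qed

definition candidates :: "'v set \<Rightarrow> 'v set set list \<Rightarrow> 'v set set" where
  "candidates W as = {{u, v} |u v. u \<in> W \<and> v \<in> W \<and> u \<noteq> v \<and> \<not> separated as u v}"

lemma finite_candidates: "finite W \<Longrightarrow> finite (candidates W as)"
  by (rule finite_subset[of _ "Pow W"]) (auto simp: candidates_def)

lemma induced_edges_subset_candidates:
  assumes "simple_graph V E"
  shows "induced_edges E W \<subseteq> candidates W (map (cc_oracle E) Ss)"
proof
  fix e assume "e \<in> induced_edges E W"
  hence e: "e \<in> E" "e \<subseteq> W" by (auto simp: induced_edges_def)
  then obtain u v where uv: "e = {u, v}" "u \<noteq> v"
    using simple_graph_edgeE[OF assms] by metis
  moreover have "\<not> separated (map (cc_oracle E) Ss) u v"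
    using edge_not_separated e uv by metis
  ultimately show "e \<in> candidates W (map (cc_oracle E) Ss)"
    using e unfolding candidates_def by blast
qed

section \<open>The algorithm\<close>

text \<open>A nonadaptive batch of queries inside a decision tree; \<open>k\<close> receives all
  answers at once.\<close>

primrec ask :: "'v set list \<Rightarrow> ('v set set list \<Rightarrow> 'v strategy) \<Rightarrow> 'v strategy" where
  "ask [] k = k []"
| "ask (S # Ss) k = Query S (\<lambda>a. ask Ss (\<lambda>as. k (a # as)))"

lemma result_ask: "result orc (ask Ss k) = result orc (k (map orc Ss))"
  by (induction Ss arbitrary: k) auto

lemma queries_ask: "queries orc (ask Ss k) = Ss @ queries orc (k (map orc Ss))"
  by (induction Ss arbitrary: k) auto

text \<open>\<open>W\<close> is the remaining vertex set and \<open>F\<close> collects the edges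
  found. True degrees are unknown, so the threshold \<open>t\<close> is applied to degrees in the
  candidate graph \<open>H\<close>. Every candidate meeting \<open>L\<close> is recorded, since
  later rounds no longer see it.\<close>

primrec peel :: "nat \<Rightarrow> 'v set list \<Rightarrow> nat \<Rightarrow> 'v set \<Rightarrow> 'v set set \<Rightarrow> 'v strategy" where
  "peel t Ss 0 W F = Output F"
| "peel t Ss (Suc r) W F =
    ask (map (\<lambda>S. S \<inter> W) Ss)
      (\<lambda>as. let H = candidates W as; L = {u \<in> W. degree H u \<le> t}
            in peel t Ss r (W - L) (F \<union> {e \<in> H. e \<inter> L \<noteq> {}}))"

text \<open>Each round asks one query per sample whatever the answers are, and the remaining set
  only shrinks.\<close>

lemma queries_peel:
  assumes "W \<subseteq> V"
  shows "(\<forall>S\<in>set (queries orc (peel t Ss r W F)). S \<subseteq> V) \<and>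
    length (queries orc (peel t Ss r W F)) = r * length Ss"
  using assms
proof (induction r arbitrary: W F)
  case (Suc r)
  have "W - L \<subseteq> V" for L using Suc.prems by blast
  from Suc.IH[OF this] Suc.prems show ?case
    by (auto simp: queries_ask Let_def)
qed simp

section \<open>Correctness of the rounds on good samples\<close>

text \<open>The good event for round \<open>i\<close>. It refers to the fixed cores and not to the
  actual run, so reusing the samples in all rounds creates no dependence.\<close>

definition resolves :: "'v set \<Rightarrow> 'v set set \<Rightarrow> nat \<Rightarrow> 'v set list \<Rightarrow> nat \<Rightarrow> bool" where
  "resolves V E t Ss i \<longleftrightarrow>
    (\<forall>u \<in> core V E t i - core V E t (Suc i). \<forall>v \<in> core V E t i.
       u \<noteq> v \<and> {u, v} \<notin> E \<longrightarrow> (\<exists>S\<in>set Ss. isolates E (core V E t i) u v S))"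

text \<open>In a good round the candidates at a vertex leaving the core are exactly its edges in
  \<open>W\<close>, so the run removes the same vertices as the ideal one and records exactly the
  edges lost with them.\<close>

lemma result_peel_step:
  assumes G: "simple_graph V E" and res: "resolves V E t Ss i"
  defines "W \<equiv> core V E t i"
  defines "H \<equiv> candidates W (map (cc_oracle E) (map (\<lambda>S. S \<inter> W) Ss))"
  defines "L \<equiv> {u \<in> W. degree H u \<le> t}"
  shows "W - L = core V E t (Suc i)"
    and "E - induced_edges E W \<union> {e \<in> H. e \<inter> L \<noteq> {}} = E - induced_edges E (core V E t (Suc i))"
proof -
  have finW: "finite W"
    using G core_subset unfolding W_def simple_graph_def by (metis finite_subset)
  have sub: "induced_edges E W \<subseteq> H"
    unfolding H_def by (rule induced_edges_subset_candidates[OF G])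
  have exact: "e \<in> induced_edges E W"
    if u: "u \<in> W" "u \<notin> core V E t (Suc i)" and e: "e \<in> H" "u \<in> e" for u e
  proof -
    from e(1) obtain a b where ab: "e = {a, b}" "a \<in> W" "b \<in> W" "a \<noteq> b"
        "\<not> separated (map (cc_oracle E) (map (\<lambda>S. S \<inter> W) Ss)) a b"
      unfolding H_def candidates_def by blast
    \<comment> \<open>Orients the unordered candidate so that \<open>u\<close> comes first;
      \<open>separated\<close> is symmetric.\<close>
    obtain v where v: "e = {u, v}" "v \<in> W" "u \<noteq> v"
        "\<not> separated (map (cc_oracle E) (map (\<lambda>S. S \<inter> W) Ss)) u v"
    proof (cases "u = a")
      case True
      thus ?thesis using that[of b] ab by simp
    next
      case False
      hence "u = b" using e(2) ab(1) by simp
      moreover have "e = {b, a}" using ab(1) by auto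
      ultimately show ?thesis using that[of a] ab separated_commute by metis
    qed
    have "\<not> (\<exists>S\<in>set Ss. isolates E W u v S)"
      using isolates_imp_separated v u by metis
    hence "{u, v} \<in> E"
      using res u v unfolding resolves_def W_def by blast
    thus ?thesis using v u by (auto simp: induced_edges_def)
  qed
  have L: "L = W - core V E t (Suc i)"
  proof (intro equalityI subsetI)
    fix u assume u: "u \<in> L"
    \<comment> \<open>Candidate degrees never undershoot true degrees, so no vertex of the next core
      is removed. For a vertex leaving the core the two degrees agree.\<close>
    have "degree (induced_edges E W) u \<le> degree H u"
      unfolding degree_def
      by (rule card_mono) (use sub finite_candidates[OF finW] in \<open>auto simp: H_def\<close>)
    thus "u \<in> W - core V E t (Suc i)" using u by (auto simp: L_def W_def)
  next
    fix u assume u: "u \<in> W - core V E t (Suc i)"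
    hence "e \<in> H \<and> u \<in> e \<longleftrightarrow> e \<in> induced_edges E W \<and> u \<in> e" for e
      using exact[of u e] sub by auto
    hence "degree H u = degree (induced_edges E W) u" by (simp add: degree_def)
    moreover have "u \<in> W" "degree (induced_edges E W) u \<le> t" using u by (auto simp: W_def)
    ultimately show "u \<in> L" by (simp add: L_def)
  qed
  have "core V E t (Suc i) \<subseteq> W" by (auto simp: W_def)
  thus "W - L = core V E t (Suc i)" using L by blast
  show "E - induced_edges E W \<union> {e \<in> H. e \<inter> L \<noteq> {}} = E - induced_edges E (core V E t (Suc i))"
    (is "?A = ?B")
  proof (intro equalityI subsetI)
    fix e assume "e \<in> ?A"
    thus "e \<in> ?B"
    proof
      assume "e \<in> {e \<in> H. e \<inter> L \<noteq> {}}"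
      then obtain u where u: "u \<in> W" "u \<notin> core V E t (Suc i)" and e: "e \<in> H" "u \<in> e"
        using L by blast
      from exact[OF this] show ?thesis using u(2) e(2) by (auto simp: induced_edges_def)
    qed (use \<open>core V E t (Suc i) \<subseteq> W\<close> in \<open>auto simp: induced_edges_def\<close>)
  next
    fix e assume "e \<in> ?B"
    thus "e \<in> ?A" using L sub by (auto simp: induced_edges_def)
  qed
qed

text \<open>Invariant: before round \<open>i\<close> the accumulator holds precisely the edges not
  contained in the \<open>i\<close>-th core.\<close>

lemma result_peel:
  assumes "simple_graph V E" "\<forall>j<i + r. resolves V E t Ss j"
  shows "result (cc_oracle E) (peel t Ss r (core V E t i) (E - induced_edges E (core V E t i)))
    = E - induced_edges E (core V E t (i + r))"
  using assms(2)
proof (induction r arbitrary: i)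
  case (Suc r)
  have "resolves V E t Ss i" using Suc.prems by simp
  note step = result_peel_step[OF assms(1) this]
  have "result (cc_oracle E) (peel t Ss (Suc r) (core V E t i) (E - induced_edges E (core V E t i)))
      = result (cc_oracle E)
          (peel t Ss r (core V E t (Suc i)) (E - induced_edges E (core V E t (Suc i))))"
    unfolding peel.simps result_ask Let_def step ..
  also have "\<dots> = E - induced_edges E (core V E t (Suc i + r))"
    using Suc.IH[of "Suc i"] Suc.prems by simp
  finally show ?case by simp
qed simp

lemma result_peel_eq:
  assumes G: "simple_graph V E" and d: "d = degeneracy V E" "d > 0" and "card V < 2 ^ r"
    and "\<forall>j<r. resolves V E (4 * d) Ss j"
  shows "result (cc_oracle E) (peel (4 * d) Ss r V {}) = E"
proof -
  \<comment> \<open>The invariant of \<open>result_peel\<close> starts with the empty accumulator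
    and, once the core is empty, ends with all of \<open>E\<close>.\<close>
  have V: "E - induced_edges E V = {}"
    using G by (auto simp: induced_edges_def simple_graph_def)
  have "induced_edges E {} = {}"
    using G by (auto simp: induced_edges_def simple_graph_def)
  thus ?thesis
    using result_peel[OF G, of 0 r "4 * d" Ss] assms(5) core_eq_empty[OF G d assms(4)]
    by (simp add: V)
qed

section \<open>Failure probability\<close>

definition random_subset :: "'v set \<Rightarrow> real \<Rightarrow> 'v set pmf" where
  "random_subset V q = map_pmf (\<lambda>f. {v \<in> V. f v}) (Pi_pmf V False (\<lambda>_. bernoulli_pmf q))"

lemma prob_random_subset:
  assumes "finite V" "0 \<le> q" "q \<le> 1" "A \<subseteq> V" "B \<subseteq> V" "A \<inter> B = {}"
  shows "measure_pmf.prob (random_subset V q) {S. A \<subseteq> S \<and> S \<inter> B = {}} = q ^ card A * (1 - q) ^ card B"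
proof -
  \<comment> \<open>The coin values allowed at each vertex; they turn the event into a product of
    independent ones.\<close>
  let ?X = "\<lambda>v. if v \<in> A then {True} else if v \<in> B then {False} else UNIV"
  have "(\<lambda>f. {v \<in> V. f v}) -` {S. A \<subseteq> S \<and> S \<inter> B = {}} = Pi V ?X"
    using assms(4-6) by (auto simp: Pi_def split: if_splits)
  hence "measure_pmf.prob (random_subset V q) {S. A \<subseteq> S \<and> S \<inter> B = {}}
      = (\<Prod>v\<in>V. measure_pmf.prob (bernoulli_pmf q) (?X v))"
    using assms(1) by (simp add: random_subset_def measure_Pi_pmf_Pi)
  also have "\<dots> = (\<Prod>v\<in>V. (if v \<in> A then q else 1) * (if v \<in> B then 1 - q else 1))"
    by (rule prod.cong) (use assms in \<open>auto simp: measure_pmf_single\<close>)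
  also have "\<dots> = q ^ card A * (1 - q) ^ card B"
    using assms(1,4,5) by (simp add: prod.distrib prod.If_cases Int_absorb1)
  finally show ?thesis .
qed

lemma card_neighbours_le_degree:
  assumes G: "simple_graph V E" and "W \<subseteq> V" "u \<in> W"
  shows "card {w \<in> W. {u, w} \<in> E} \<le> degree (induced_edges E W) u"
  unfolding degree_def
proof (rule card_inj_on_le)
  show "inj_on (\<lambda>w. {u, w}) {w \<in> W. {u, w} \<in> E}"
    by (auto simp: inj_on_def doubleton_eq_iff)
  show "(\<lambda>w. {u, w}) ` {w \<in> W. {u, w} \<in> E} \<subseteq> {e \<in> induced_edges E W. u \<in> e}"
    using \<open>u \<in> W\<close> by (auto simp: induced_edges_def)
  show "finite {e \<in> induced_edges E W. u \<in> e}"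
    using finite_induced_edges[OF simple_graph_finite_edges[OF G]] by simp
qed

text \<open>Both \<open>u\<close> and \<open>v\<close> are kept with probability
  \<open>1 / (64 d^2)\<close>. Independently, all of the at most \<open>4 d\<close> neighbours of
  \<open>u\<close> are dropped with probability at least \<open>1 - 4 d / (8 d) = 1 / 2\<close>, by
  Bernoulli's inequality.\<close>

lemma prob_isolates_ge:
  assumes G: "simple_graph V E" and W: "W \<subseteq> V" "u \<in> W" "v \<in> W"
    and uv: "u \<noteq> v" "{u, v} \<notin> E" and deg: "degree (induced_edges E W) u \<le> 4 * d" and "d > 0"
  shows "measure_pmf.prob (random_subset V (1 / (8 * real d))) {S. isolates E W u v S}
    \<ge> 1 / (128 * (real d)\<^sup>2)"
proof -
  let ?q = "1 / (8 * real d)" and ?N = "{w \<in> W. {u, w} \<in> E}"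
  have q: "0 \<le> ?q" "?q \<le> 1" using \<open>d > 0\<close> by (auto simp: field_simps)
  have finV: "finite V" using G by (simp add: simple_graph_def)
  \<comment> \<open>Without loops, and with \<open>v\<close> not adjacent to \<open>u\<close>, the
    vertices to keep and those to drop are disjoint.\<close>
  have "{u, u} \<notin> E" using G by (auto simp: simple_graph_def)
  hence "{u, v} \<inter> ?N = {}" using uv by auto
  have "1 / 2 = 1 + real (4 * d) * (- ?q)" using \<open>d > 0\<close> by (simp add: field_simps)
  also have "\<dots> \<le> (1 + - ?q) ^ (4 * d)" by (rule Bernoulli_inequality) (use q in simp)
  also have "\<dots> = (1 - ?q) ^ (4 * d)" by simp
  also have "\<dots> \<le> (1 - ?q) ^ card ?N"
    by (rule power_decreasing) (use q deg card_neighbours_le_degree[OF G W(1,2)] in auto)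
  finally have half: "1 / 2 \<le> (1 - ?q) ^ card ?N" .
  have "1 / (128 * (real d)\<^sup>2) = ?q ^ 2 * (1 / 2)"
    by (simp add: power2_eq_square)
  also have "\<dots> \<le> ?q ^ 2 * (1 - ?q) ^ card ?N"
    by (rule mult_left_mono[OF half]) simp
  also have "\<dots> = measure_pmf.prob (random_subset V ?q) {S. {u, v} \<subseteq> S \<and> S \<inter> ?N = {}}"
  proof -
    have "{u, v} \<subseteq> V" "?N \<subseteq> V" "card {u, v} = 2" using W uv(1) by auto
    thus ?thesis using prob_random_subset[OF finV q, of "{u, v}" ?N] \<open>{u, v} \<inter> ?N = {}\<close> by metis
  qed
  also have "{S. {u, v} \<subseteq> S \<and> S \<inter> ?N = {}} = {S. isolates E W u v S}"
    by (auto simp: isolates_def)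
  finally show ?thesis .
qed

definition samples :: "'v set \<Rightarrow> nat \<Rightarrow> nat \<Rightarrow> 'v set list pmf" where
  "samples V d k = map_pmf (\<lambda>f. map f [0..<k])
     (Pi_pmf {..<k} {} (\<lambda>_. random_subset V (1 / (8 * real d))))"

text \<open>The samples are independent, so the failure probabilities multiply, and
  \<open>1 - x <= exp (- x)\<close> bounds the product.\<close>

lemma prob_not_isolated_le:
  assumes "simple_graph V E" "W \<subseteq> V" "u \<in> W" "v \<in> W" "u \<noteq> v" "{u, v} \<notin> E"
    "degree (induced_edges E W) u \<le> 4 * d" "d > 0"
  shows "measure_pmf.prob (samples V d (512 * d\<^sup>2 * l)) {Ss. \<forall>S\<in>set Ss. \<not> isolates E W u v S}
    \<le> (1 / 16) ^ l"
proof -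
  let ?R = "random_subset V (1 / (8 * real d))" and ?k = "512 * d\<^sup>2 * l"
  let ?x = "1 / (128 * (real d)\<^sup>2)" and ?N = "{S. \<not> isolates E W u v S}"
  have "(\<lambda>f. map f [0..<?k]) -` {Ss. \<forall>S\<in>set Ss. \<not> isolates E W u v S} = Pi {..<?k} (\<lambda>_. ?N)"
    by auto
  hence "measure_pmf.prob (samples V d ?k) {Ss. \<forall>S\<in>set Ss. \<not> isolates E W u v S}
      = measure_pmf.prob ?R ?N ^ ?k"
    by (simp add: samples_def measure_Pi_pmf_Pi)
  also have "\<dots> \<le> exp (- ?x) ^ ?k"
  proof (rule power_mono)
    have "measure_pmf.prob ?R ?N = 1 - measure_pmf.prob ?R {S. isolates E W u v S}"
      by (subst measure_pmf.prob_compl[symmetric])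
        (auto intro!: arg_cong[where f = "measure_pmf.prob ?R"])
    also have "\<dots> \<le> 1 - ?x" using prob_isolates_ge[OF assms] by simp
    also have "\<dots> \<le> exp (- ?x)" using exp_ge_add_one_self[of "- ?x"] by simp
    finally show "measure_pmf.prob ?R ?N \<le> exp (- ?x)" .
  qed simp
  also have "\<dots> = exp (real ?k * (- ?x))" by (rule exp_of_nat_mult[symmetric])
  \<comment> \<open>The factor 512 is \<open>4 * 128\<close>: the exponent becomes
    \<open>- 4 l\<close>, and \<open>exp 1 >= 2\<close> turns this into
    \<open>(1 / 16) ^ l\<close>.\<close>
  also have "real ?k * (- ?x) = real l * (- 4)" using \<open>d > 0\<close> by (simp add: field_simps)
  also have "exp (real l * (- 4)) = exp (- 4 :: real) ^ l" by (rule exp_of_nat_mult)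
  also have "\<dots> \<le> (1 / 16) ^ l"
  proof (rule power_mono)
    have "(2 :: real) ^ 4 \<le> exp 1 ^ 4" using exp_ge_add_one_self[of 1] by (intro power_mono) auto
    also have "\<dots> = exp 4" using exp_of_nat_mult[of 4 "1 :: real"] by simp
    finally show "exp (- 4 :: real) \<le> 1 / 16" by (simp add: exp_minus field_simps)
  qed simp
  finally show ?thesis .
qed

text \<open>Union bound over a round and a pair of vertices: at most \<open>l * n^2 <= 8 ^ l\<close>
  triples, each failing with probability at most \<open>(1 / 16) ^ l\<close>.\<close>

lemma prob_not_resolves_le:
  assumes G: "simple_graph V E" and "d > 0" and l: "card V \<le> 2 ^ l"
  shows "measure_pmf.prob (samples V d (512 * d\<^sup>2 * l)) {Ss. \<exists>i<l. \<not> resolves V E (4 * d) Ss i}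
    \<le> (1 / 2) ^ l"
proof -
  let ?M = "samples V d (512 * d\<^sup>2 * l)" and ?c = "core V E (4 * d)"
  define J where "J = {(i, u, v). i < l \<and> u \<in> ?c i - ?c (Suc i) \<and> v \<in> ?c i \<and> u \<noteq> v \<and> {u, v} \<notin> E}"
  define B where "B = (\<lambda>(i, u, v). {Ss. \<forall>S\<in>set Ss. \<not> isolates E (?c i) u v S})"
  have finV: "finite V" using G by (simp add: simple_graph_def)
  have J_sub: "J \<subseteq> {..<l} \<times> V \<times> V" using core_subset by (fastforce simp: J_def)
  have finJ: "finite J" by (rule finite_subset[OF J_sub]) (use finV in simp)
  have "card J \<le> l * (card V * card V)"
    using card_mono[OF _ J_sub] finV by (simp add: card_cartesian_product)
  also have "\<dots> \<le> 2 ^ l * (2 ^ l * 2 ^ l)"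
    using l by (intro mult_mono) (auto intro: less_imp_le less_exp)
  finally have "card J \<le> 8 ^ l" by (simp flip: power_mult_distrib)
  hence J: "real (card J) \<le> 8 ^ l" by (metis of_nat_le_iff of_nat_numeral of_nat_power)
  have "{Ss. \<exists>i<l. \<not> resolves V E (4 * d) Ss i} \<subseteq> (\<Union>j\<in>J. B j)"
    unfolding resolves_def J_def B_def by fastforce
  hence "measure_pmf.prob ?M {Ss. \<exists>i<l. \<not> resolves V E (4 * d) Ss i}
      \<le> measure_pmf.prob ?M (\<Union>j\<in>J. B j)"
    by (intro measure_pmf.finite_measure_mono) auto
  also have "\<dots> \<le> (\<Sum>j\<in>J. measure_pmf.prob ?M (B j))"
    using finJ by (intro measure_pmf.finite_measure_subadditive_finite) auto
  also have "\<dots> \<le> (\<Sum>j\<in>J. (1 / 16) ^ l)"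
  proof (rule sum_mono)
    fix j assume "j \<in> J"
    then obtain i u v where j: "j = (i, u, v)" "u \<in> ?c i" "u \<notin> ?c (Suc i)" "v \<in> ?c i"
      "u \<noteq> v" "{u, v} \<notin> E" by (auto simp: J_def)
    \<comment> \<open>A vertex dropped in round \<open>i\<close> has low degree in the
      \<open>i\<close>-th core by the definition of \<open>core\<close>.\<close>
    hence "degree (induced_edges E (?c i)) u \<le> 4 * d" by simp
    thus "measure_pmf.prob ?M (B j) \<le> (1 / 16) ^ l"
      using prob_not_isolated_le[OF G core_subset j(2,4-6)] \<open>d > 0\<close> by (simp add: B_def j(1))
  qed
  also have "\<dots> \<le> 8 ^ l * (1 / 16) ^ l" using J by (simp add: mult_right_mono)
  also have "\<dots> = (1 / 2) ^ l" by (simp flip: power_mult_distrib)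
  finally show ?thesis .
qed

section \<open>Query bound and success probability of the algorithm\<close>

text \<open>Degeneracy 0 is split off because the rate \<open>1 / (8 d)\<close> makes sense only for
  positive \<open>d\<close>. For \<open>n > 0\<close>, \<open>floorlog 2 n\<close> is the floor of
  the logarithm plus one, so \<open>2 ^ l > n\<close>; this \<open>l\<close> serves both as the
  number of rounds and as the scale of the sample size.\<close>

definition reconstruct :: "'v set \<Rightarrow> nat \<Rightarrow> 'v strategy pmf" where
  "reconstruct V d = (if d = 0 then return_pmf (Output {}) else
     let l = floorlog 2 (card V)
     in map_pmf (\<lambda>Ss. peel (4 * d) Ss l V {}) (samples V d (512 * d\<^sup>2 * l)))"

text \<open>There are \<open>l\<close> rounds with \<open>512 d^2 l\<close> queries each, and
  \<open>l <= 2 log n\<close> gives the constant \<open>2048 = 512 * 4\<close>. The bound holds for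
  every tree in the support, not just on average.\<close>

lemma reconstruct_queries:
  assumes G: "simple_graph V E" and d: "d = degeneracy V E" and T: "T \<in> set_pmf (reconstruct V d)"
  shows "(\<forall>S\<in>set (queries orc T). S \<subseteq> V) \<and>
    real (length (queries orc T)) \<le> 2048 * (real d)\<^sup>2 * (log 2 (real (card V)))\<^sup>2"
proof (cases "d = 0")
  case True
  thus ?thesis using T by (simp add: reconstruct_def)
next
  case False
  let ?l = "floorlog 2 (card V)"
  have n: "card V \<ge> 2" using card_ge_2_if_degeneracy_pos[OF G] False d by simp
  hence log: "log 2 (real (card V)) \<ge> 1" by simp
  hence "real ?l = of_int \<lfloor>log 2 (real (card V))\<rfloor> + 1"
    using n by (simp add: floorlog_def)
  hence "real ?l \<le> 2 * log 2 (real (card V))"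
    using log of_int_floor_le[of "log 2 (real (card V))"] by linarith
  hence "(real ?l)\<^sup>2 \<le> (2 * log 2 (real (card V)))\<^sup>2" by (intro power_mono) auto
  hence l: "512 * (real d)\<^sup>2 * (real ?l)\<^sup>2 \<le> 512 * (real d)\<^sup>2 * (2 * log 2 (real (card V)))\<^sup>2"
    by (intro mult_left_mono) auto
  from T False obtain Ss where T: "T = peel (4 * d) Ss ?l V {}"
    and Ss: "Ss \<in> set_pmf (samples V d (512 * d\<^sup>2 * ?l))"
    by (auto simp: reconstruct_def Let_def)
  from Ss have "length Ss = 512 * d\<^sup>2 * ?l" by (auto simp: samples_def)
  hence "real (length (queries orc T)) = 512 * (real d)\<^sup>2 * (real ?l)\<^sup>2"
    using queries_peel[of V V orc] by (simp add: T power2_eq_square)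
  with l show ?thesis using queries_peel[of V V orc] by (simp add: T power_mult_distrib)
qed

lemma reconstruct_correct:
  assumes G: "simple_graph V E" and d: "d = degeneracy V E"
  shows "measure_pmf.prob (reconstruct V d) {T. result (cc_oracle E) T = E} \<ge> 1 - 1 / real (card V)"
proof (cases "d = 0")
  case True
  \<comment> \<open>This covers the empty vertex set, where \<open>1 / real 0 = 0\<close> and the
    bound asks for certainty.\<close>
  thus ?thesis using degeneracy_eq_0_iff[OF G] d by (simp add: reconstruct_def)
next
  case False
  let ?l = "floorlog 2 (card V)"
  let ?M = "samples V d (512 * d\<^sup>2 * ?l)"
  let ?B = "{Ss. \<exists>i<?l. \<not> resolves V E (4 * d) Ss i}"
  have n: "card V \<ge> 2" using card_ge_2_if_degeneracy_pos[OF G] False d by simp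
  hence l: "card V < 2 ^ ?l" using floorlog_bounds[of "card V" 2] by simp
  have "real (card V) \<le> 2 ^ ?l" using l by (metis less_imp_le of_nat_le_iff of_nat_numeral of_nat_power)
  \<comment> \<open>Since \<open>2 ^ l\<close> exceeds \<open>n\<close>, the failure bound
    \<open>(1 / 2) ^ l\<close> is at most \<open>1 / n\<close>.\<close>
  hence "(1 / 2) ^ ?l \<le> 1 / real (card V)" using n by (simp add: power_one_over frac_le)
  hence "1 - 1 / real (card V) \<le> 1 - measure_pmf.prob ?M ?B"
    using prob_not_resolves_le[OF G _ less_imp_le[OF l], of d] False by simp
  also have "\<dots> = measure_pmf.prob ?M (UNIV - ?B)"
    by (subst measure_pmf.prob_compl[symmetric]) auto
  also have "\<dots> \<le> measure_pmf.prob ?M {Ss. result (cc_oracle E) (peel (4 * d) Ss ?l V {}) = E}"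
    using result_peel_eq[OF G d _ l] False
    by (intro measure_pmf.finite_measure_mono) auto
  also have "\<dots> = measure_pmf.prob (reconstruct V d) {T. result (cc_oracle E) T = E}"
    using False by (simp add: reconstruct_def Let_def vimage_def)
  finally show ?thesis .
qed

theorem theorem9:
  "\<exists>(A :: 'v set \<Rightarrow> nat \<Rightarrow> 'v strategy pmf) (C :: real) (p :: nat \<Rightarrow> real).
     p \<longlonglongrightarrow> 1 \<and>
     (\<forall>V E d. simple_graph V E \<and> d = degeneracy V E \<longrightarrow>
        (\<forall>T \<in> set_pmf (A V d).
           (\<forall>S \<in> set (queries (cc_oracle E) T). S \<subseteq> V) \<and>
           real (length (queries (cc_oracle E) T))
             \<le> C * (real d)\<^sup>2 * (log 2 (real (card V)))\<^sup>2) \<and>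
        measure_pmf.prob (A V d) {T. result (cc_oracle E) T = E} \<ge> p (card V))"
proof -
  \<comment> \<open>The witnesses are \<open>reconstruct\<close>, the constant 2048 and this
    sequence for \<open>p\<close>.\<close>
  have "(\<lambda>n. 1 - 1 / real n) \<longlonglongrightarrow> 1"
    using tendsto_diff[OF tendsto_const lim_1_over_n, of 1] by simp
  thus ?thesis
    using reconstruct_queries reconstruct_correct by blast
qed

end
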